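(* Let $(T,\eta,(-)^\dagger)$ be a monad on $\mathbf{Cont}$ and let $\mathsf{c}:\langle\!\langle-\rangle\!\rangle\to\langle\!\langle T(-)\rangle\!\rangle$ be the structure map of a right $T$-comodule with carrier $\langle\!\langle-\rangle\!\rangle$. Call a map $F:\langle\!\langle A\triangleleft P\rangle\!\rangle\to\langle\!\langle B\triangleleft Q\rangle\!\rangle$ representable if there exists a container morphism $\tau\triangleleft e:B\triangleleft Q\to T(A\triangleleft P)$ with $F=\langle\!\langle\tau\triangleleft e\rangle\!\rangle\circ\mathsf{c}_{A\triangleleft P}$. Then for every container $A\triangleleft P$ the identity map on $\langle\!\langle A\triangleleft P\rangle\!\rangle$ is representable, and if $F:\langle\!\langle A\triangleleft P\rangle\!\rangle\to\langle\!\langle B\triangleleft Q\rangle\!\rangle$ and $G:\langle\!\langle B\triangleleft Q\rangle\!\rangle\to\langle\!\langle C\triangleleft R\rangle\!\rangle$ are representable then so is $G\circ F$. Hence the representable functionals form a subcategory $\mathbf{RFun}(T,\langle\!\langle-\rangle\!\rangle,\mathsf{c})$ of the category $\mathbf{Fun}$ whose objects are containers and whose morphisms $A\triangleleft P\to B\triangleleft Q$ are all maps $\langle\!\langle A\triangleleft P\rangle\!\rangle\to\langle\!\langle B\triangleleft Q\rangle\!\rangle$.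
   Context: Work in extensional Martin-Löf type theory. $\mathbf{Cont}$ is the category of containers $A\triangleleft P$ ($A$ a type, $P:A\to\mathbf{Type}$) with morphisms $f\triangleleft g:A\triangleleft P\to B\triangleleft Q$ given by $f:A\to B$ and $g:\prod_{\{a:A\}}(Q\,(f\,a)\to P\,a)$, composition $(k\triangleleft l)\circ(f\triangleleft g)=(k\circ f)\triangleleft(\lambda\{a\}.\,g\{a\}\circ l\{f\,a\})$. The functor $\langle\!\langle-\rangle\!\rangle:\mathbf{Cont}^{\mathrm{op}}\to\mathbf{Type}$ is $\langle\!\langle A\triangleleft P\rangle\!\rangle=\prod_{a:A}P\,a$, and for $f\triangleleft g:A\triangleleft P\to B\triangleleft Q$, $\langle\!\langle f\triangleleft g\rangle\!\rangle\,\alpha=\lambda a.\,g\{a\}(\alpha(f\,a))$. A right $T$-comodule structure map on $\langle\!\langle-\rangle\!\rangle$ is a natural transformation $\mathsf{c}:\langle\!\langle-\rangle\!\rangle\to\langle\!\langle T(-)\rangle\!\rangle$ (naturality: $\langle\!\langle Tk\rangle\!\rangle\circ\mathsf{c}_Y=\mathsf{c}_X\circ\langle\!\langle k\rangle\!\rangle$ for $k:X\to Y$) such that $\langle\!\langle\eta_X\rangle\!\rangle\circ\mathsf{c}_X=\mathrm{id}$ and $\mathsf{c}_{TX}\circ\mathsf{c}_X=\langle\!\langle\mu_X\rangle\!\rangle\circ\mathsf{c}_X$, where $\mu_X=(\mathrm{id}_{TX})^\dagger$ and $Tk=(\eta\circ k)^\dagger$. *)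

theory Defs
  imports "HOL-Library.FuncSet"
begin

section \<open>Categories, subcategories and monads\<close>

text \<open>
  Morphisms do not carry their domain and codomain, so identities and composition take the objects
  as arguments: \<open>Comp C X Y Z g f\<close> is \<open>g \<circ> f\<close> for \<open>f : X \<rightarrow> Y\<close> and \<open>g : Y \<rightarrow> Z\<close>.
\<close>

record ('o, 'm) cat =
  Obj :: "'o set"
  Hom :: "'o \<Rightarrow> 'o \<Rightarrow> 'm set"
  Id :: "'o \<Rightarrow> 'm"
  Comp :: "'o \<Rightarrow> 'o \<Rightarrow> 'o \<Rightarrow> 'm \<Rightarrow> 'm \<Rightarrow> 'm"

locale category =
  fixes C :: "('o, 'm) cat"
  assumes Id_Hom: "X \<in> Obj C \<Longrightarrow> Id C X \<in> Hom C X X"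
    and Comp_Hom: "\<lbrakk>X \<in> Obj C; Y \<in> Obj C; Z \<in> Obj C; f \<in> Hom C X Y; g \<in> Hom C Y Z\<rbrakk>
      \<Longrightarrow> Comp C X Y Z g f \<in> Hom C X Z"
    and Comp_Id_right: "\<lbrakk>X \<in> Obj C; Y \<in> Obj C; f \<in> Hom C X Y\<rbrakk>
      \<Longrightarrow> Comp C X X Y f (Id C X) = f"
    and Comp_Id_left: "\<lbrakk>X \<in> Obj C; Y \<in> Obj C; f \<in> Hom C X Y\<rbrakk>
      \<Longrightarrow> Comp C X Y Y (Id C Y) f = f"
    and Comp_assoc: "\<lbrakk>W \<in> Obj C; X \<in> Obj C; Y \<in> Obj C; Z \<in> Obj C;
        f \<in> Hom C W X; g \<in> Hom C X Y; h \<in> Hom C Y Z\<rbrakk>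
      \<Longrightarrow> Comp C W Y Z h (Comp C W X Y g f) = Comp C W X Z (Comp C X Y Z h g) f"

definition subcategory :: "('o, 'm) cat \<Rightarrow> ('o, 'm) cat \<Rightarrow> bool" where
  "subcategory S C \<longleftrightarrow>
    category C \<and> category S \<and>
    Obj S \<subseteq> Obj C \<and>
    (\<forall>X\<in>Obj S. \<forall>Y\<in>Obj S. Hom S X Y \<subseteq> Hom C X Y) \<and>
    (\<forall>X\<in>Obj S. Id S X = Id C X) \<and>
    (\<forall>X\<in>Obj S. \<forall>Y\<in>Obj S. \<forall>Z\<in>Obj S. \<forall>f\<in>Hom S X Y. \<forall>g\<in>Hom S Y Z.
      Comp S X Y Z g f = Comp C X Y Z g f)"

text \<open>
  Monads in extension form; \<open>ext X Y f\<close> is \<open>f\<^sup>\<dagger> : T X \<rightarrow> T Y\<close> for \<open>f : X \<rightarrow> T Y\<close>.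
\<close>

locale monad = category C
  for C :: "('o, 'm) cat" +
  fixes T :: "'o \<Rightarrow> 'o"
    and \<eta> :: "'o \<Rightarrow> 'm"
    and ext :: "'o \<Rightarrow> 'o \<Rightarrow> 'm \<Rightarrow> 'm"
  assumes T_Obj: "X \<in> Obj C \<Longrightarrow> T X \<in> Obj C"
    and unit_Hom: "X \<in> Obj C \<Longrightarrow> \<eta> X \<in> Hom C X (T X)"
    and ext_Hom: "\<lbrakk>X \<in> Obj C; Y \<in> Obj C; f \<in> Hom C X (T Y)\<rbrakk>
      \<Longrightarrow> ext X Y f \<in> Hom C (T X) (T Y)"
    and ext_unit: "X \<in> Obj C \<Longrightarrow> ext X X (\<eta> X) = Id C (T X)"
    and ext_Comp_unit: "\<lbrakk>X \<in> Obj C; Y \<in> Obj C; f \<in> Hom C X (T Y)\<rbrakk>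
      \<Longrightarrow> Comp C X (T X) (T Y) (ext X Y f) (\<eta> X) = f"
    and ext_Comp_ext: "\<lbrakk>X \<in> Obj C; Y \<in> Obj C; Z \<in> Obj C;
        f \<in> Hom C X (T Y); g \<in> Hom C Y (T Z)\<rbrakk>
      \<Longrightarrow> ext X Z (Comp C X (T Y) (T Z) (ext Y Z g) f)
          = Comp C (T X) (T Y) (T Z) (ext Y Z g) (ext X Y f)"

definition monad_mult ::
  "('o, 'm) cat \<Rightarrow> ('o \<Rightarrow> 'o) \<Rightarrow> ('o \<Rightarrow> 'o \<Rightarrow> 'm \<Rightarrow> 'm) \<Rightarrow> 'o \<Rightarrow> 'm" where
  "monad_mult C T ext X = ext (T X) X (Id C (T X))"

definition monad_map ::
  "('o, 'm) cat \<Rightarrow> ('o \<Rightarrow> 'o) \<Rightarrow> ('o \<Rightarrow> 'm) \<Rightarrow> ('o \<Rightarrow> 'o \<Rightarrow> 'm \<Rightarrow> 'm) \<Rightarrow> 'o \<Rightarrow> 'o \<Rightarrow> 'm \<Rightarrow> 'm" where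
  "monad_map C T \<eta> ext X Y k = ext X Y (Comp C X Y (T Y) (\<eta> Y) k)"


section \<open>Containers\<close>

text \<open>
  The universe \<open>Type\<close> is modelled by an arbitrary collection \<open>U\<close> of sets of elements of an arbitrary
  HOL type. Dependent functions are the extensional functions of \<^const>\<open>PiE\<close> (with a fixed
  value outside their domain), so that HOL equality is function extensionality, also for the
  position family of a container.
\<close>

datatype 'u container = Container (Shapes: "'u set") (Positions: "'u \<Rightarrow> 'u set") (infix "\<lhd>" 60)

datatype 'u cont_mor = Cont_Mor (on_shapes: "'u \<Rightarrow> 'u") (on_positions: "'u \<Rightarrow> 'u \<Rightarrow> 'u")

definition containers :: "'u set set \<Rightarrow> 'u container set" where
  "containers U = {A \<lhd> P | A P. A \<in> U \<and> P \<in> A \<rightarrow>\<^sub>E U}"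

definition cont_hom :: "'u container \<Rightarrow> 'u container \<Rightarrow> 'u cont_mor set" where
  "cont_hom X Y = {Cont_Mor f g | f g.
    f \<in> Shapes X \<rightarrow>\<^sub>E Shapes Y \<and>
    g \<in> (\<Pi>\<^sub>E a\<in>Shapes X. Positions Y (f a) \<rightarrow>\<^sub>E Positions X a)}"

definition cont_id :: "'u container \<Rightarrow> 'u cont_mor" where
  "cont_id X = Cont_Mor (\<lambda>a\<in>Shapes X. a) (\<lambda>a\<in>Shapes X. \<lambda>p\<in>Positions X a. p)"

definition cont_comp ::
  "'u container \<Rightarrow> 'u container \<Rightarrow> 'u container \<Rightarrow> 'u cont_mor \<Rightarrow> 'u cont_mor \<Rightarrow> 'u cont_mor" where
  "cont_comp X Y Z kl fg =
    (let k = on_shapes kl; l = on_positions kl; f = on_shapes fg; g = on_positions fg in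
      Cont_Mor (compose (Shapes X) k f)
        (\<lambda>a\<in>Shapes X. compose (Positions Z (k (f a))) (g a) (l (f a))))"

definition Cont :: "'u set set \<Rightarrow> ('u container, 'u cont_mor) cat" where
  "Cont U = \<lparr>Obj = containers U, Hom = cont_hom, Id = cont_id, Comp = cont_comp\<rparr>"

definition sections :: "'u container \<Rightarrow> ('u \<Rightarrow> 'u) set" where
  "sections X = (\<Pi>\<^sub>E a\<in>Shapes X. Positions X a)"

definition sections_map ::
  "'u container \<Rightarrow> 'u container \<Rightarrow> 'u cont_mor \<Rightarrow> ('u \<Rightarrow> 'u) \<Rightarrow> ('u \<Rightarrow> 'u)" where
  "sections_map X Y fg =
    (\<lambda>\<alpha>\<in>sections Y. \<lambda>a\<in>Shapes X. on_positions fg a (\<alpha> (on_shapes fg a)))"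

definition Fun :: "'u set set \<Rightarrow> ('u container, ('u \<Rightarrow> 'u) \<Rightarrow> ('u \<Rightarrow> 'u)) cat" where
  "Fun U = \<lparr>Obj = containers U,
            Hom = (\<lambda>X Y. sections X \<rightarrow>\<^sub>E sections Y),
            Id = (\<lambda>X. \<lambda>\<alpha>\<in>sections X. \<alpha>),
            Comp = (\<lambda>X Y Z G F. compose (sections X) G F)\<rparr>"

lemma category_Cont: "category (Cont U)"
proof
  fix X assume "X \<in> Obj (Cont U)"
  show "Id (Cont U) X \<in> Hom (Cont U) X X"
    by (auto simp: Cont_def cont_id_def cont_hom_def)
next
  fix X Y Z f g assume "f \<in> Hom (Cont U) X Y" "g \<in> Hom (Cont U) Y Z"
  then show "Comp (Cont U) X Y Z g f \<in> Hom (Cont U) X Z"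
    by (auto simp: Cont_def cont_hom_def cont_comp_def compose_def Let_def PiE_iff)
next
  fix X Y f assume "f \<in> Hom (Cont U) X Y"
  then show "Comp (Cont U) X X Y f (Id (Cont U) X) = f"
    by (auto simp: Cont_def cont_hom_def cont_comp_def cont_id_def compose_def Let_def
        PiE_iff extensional_def fun_eq_iff restrict_def)
next
  fix X Y f assume "f \<in> Hom (Cont U) X Y"
  then show "Comp (Cont U) X Y Y (Id (Cont U) Y) f = f"
    by (auto simp: Cont_def cont_hom_def cont_comp_def cont_id_def compose_def Let_def
        PiE_iff extensional_def fun_eq_iff restrict_def)
next
  fix W X Y Z f g h
  assume "f \<in> Hom (Cont U) W X" "g \<in> Hom (Cont U) X Y" "h \<in> Hom (Cont U) Y Z"
  then show "Comp (Cont U) W Y Z h (Comp (Cont U) W X Y g f)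
      = Comp (Cont U) W X Z (Comp (Cont U) X Y Z h g) f"
    by (auto simp: Cont_def cont_hom_def cont_comp_def compose_def Let_def
        PiE_iff extensional_def fun_eq_iff restrict_def)
qed


section \<open>Comodules and representable functionals\<close>

locale right_comodule =
  fixes U :: "'u set set"
    and T :: "'u container \<Rightarrow> 'u container"
    and \<eta> :: "'u container \<Rightarrow> 'u cont_mor"
    and ext :: "'u container \<Rightarrow> 'u container \<Rightarrow> 'u cont_mor \<Rightarrow> 'u cont_mor"
    and c :: "'u container \<Rightarrow> ('u \<Rightarrow> 'u) \<Rightarrow> ('u \<Rightarrow> 'u)"
  assumes c_maps: "X \<in> Obj (Cont U) \<Longrightarrow> c X \<in> sections X \<rightarrow>\<^sub>E sections (T X)"
    and c_natural: "\<lbrakk>X \<in> Obj (Cont U); Y \<in> Obj (Cont U); k \<in> Hom (Cont U) X Y\<rbrakk>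
      \<Longrightarrow> compose (sections Y)
            (sections_map (T X) (T Y) (monad_map (Cont U) T \<eta> ext X Y k)) (c Y)
          = compose (sections Y) (c X) (sections_map X Y k)"
    and c_counit: "X \<in> Obj (Cont U)
      \<Longrightarrow> compose (sections X) (sections_map X (T X) (\<eta> X)) (c X) = (\<lambda>\<alpha>\<in>sections X. \<alpha>)"
    and c_coassoc: "X \<in> Obj (Cont U)
      \<Longrightarrow> compose (sections X) (c (T X)) (c X)
          = compose (sections X)
              (sections_map (T (T X)) (T X) (monad_mult (Cont U) T ext X)) (c X)"

definition representable ::
  "'u set set \<Rightarrow> ('u container \<Rightarrow> 'u container) \<Rightarrow> ('u container \<Rightarrow> ('u \<Rightarrow> 'u) \<Rightarrow> ('u \<Rightarrow> 'u)) \<Rightarrow>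
    'u container \<Rightarrow> 'u container \<Rightarrow> (('u \<Rightarrow> 'u) \<Rightarrow> ('u \<Rightarrow> 'u)) \<Rightarrow> bool" where
  "representable U T c X Y F \<longleftrightarrow>
    (\<exists>m \<in> Hom (Cont U) Y (T X). F = compose (sections X) (sections_map Y (T X) m) (c X))"

definition RFun ::
  "'u set set \<Rightarrow> ('u container \<Rightarrow> 'u container) \<Rightarrow> ('u container \<Rightarrow> ('u \<Rightarrow> 'u) \<Rightarrow> ('u \<Rightarrow> 'u)) \<Rightarrow>
    ('u container, ('u \<Rightarrow> 'u) \<Rightarrow> ('u \<Rightarrow> 'u)) cat" where
  "RFun U T c = (Fun U)\<lparr>Hom := (\<lambda>X Y. {F \<in> Hom (Fun U) X Y. representable U T c X Y F})\<rparr>"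

end

(* For F = <<m>> c_X and G = <<n>> c_Y, naturality of c at m : Y \<rightarrow> T X and coassociativity give
   G F = <<n>> c_Y <<m>> c_X = <<n>> <<T m>> c_(T X) c_X = <<n>> <<T m>> <<\<mu>_X>> c_X,
   so G F is represented by the Kleisli composite \<mu>_X \<circ> T m \<circ> n.  The identity is
   represented by \<eta>_X, which is the counit law. *)

theory Submission
  imports Defs
begin

text \<open>\<open>Id\<close> and \<open>Comp\<close> stay those of \<open>C\<close>, so the unit
  and associativity laws restrict to the smaller hom-sets; only closure under identities and
  composition remains to be assumed.\<close>

lemma category_Hom_update:
  assumes "category C"
    and "\<And>X Y. \<lbrakk>X \<in> Obj C; Y \<in> Obj C\<rbrakk> \<Longrightarrow> H X Y \<subseteq> Hom C X Y"
    and "\<And>X. X \<in> Obj C \<Longrightarrow> Id C X \<in> H X X"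
    and "\<And>X Y Z f g. \<lbrakk>X \<in> Obj C; Y \<in> Obj C; Z \<in> Obj C; f \<in> H X Y; g \<in> H Y Z\<rbrakk>
      \<Longrightarrow> Comp C X Y Z g f \<in> H X Z"
  shows "category (C\<lparr>Hom := H\<rparr>)"
proof -
  interpret category C by fact
  show ?thesis
    by standard (use assms(2-) in \<open>auto simp: subset_iff Comp_Id_right Comp_Id_left intro: Comp_assoc\<close>)
qed

lemma subcategory_Hom_update:
  assumes "category C"
    and "\<And>X Y. \<lbrakk>X \<in> Obj C; Y \<in> Obj C\<rbrakk> \<Longrightarrow> H X Y \<subseteq> Hom C X Y"
    and "\<And>X. X \<in> Obj C \<Longrightarrow> Id C X \<in> H X X"
    and "\<And>X Y Z f g. \<lbrakk>X \<in> Obj C; Y \<in> Obj C; Z \<in> Obj C; f \<in> H X Y; g \<in> H Y Z\<rbrakk>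
      \<Longrightarrow> Comp C X Y Z g f \<in> H X Z"
  shows "subcategory (C\<lparr>Hom := H\<rparr>) C"
  using assms(1,2) category_Hom_update[OF assms] by (simp add: subcategory_def)

text \<open>Morphisms are extensional on \<open>sections X\<close>, so composing with the restricted
  identity returns the very same HOL function.\<close>

lemma category_Fun: "category (Fun U)"
  by standard
    (auto simp: Fun_def compose_def PiE_iff extensional_def fun_eq_iff restrict_def)

lemma sections_map_maps:
  "m \<in> cont_hom X Y \<Longrightarrow> sections_map X Y m \<in> sections Y \<rightarrow>\<^sub>E sections X"
  by (fastforce simp: sections_map_def sections_def cont_hom_def PiE_iff)

text \<open>Contravariant functoriality: at a shape \<open>a\<close> both sides apply the position
  map of \<open>g\<close> at \<open>on_shapes f a\<close>, then that of \<open>f\<close> at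
  \<open>a\<close>.\<close>

lemma sections_map_comp:
  assumes "f \<in> cont_hom X Y" "g \<in> cont_hom Y Z"
  shows "sections_map X Z (cont_comp X Y Z g f)
    = compose (sections Z) (sections_map X Y f) (sections_map Y Z g)"
proof
  fix \<alpha>
  show "sections_map X Z (cont_comp X Y Z g f) \<alpha>
    = compose (sections Z) (sections_map X Y f) (sections_map Y Z g) \<alpha>"
  proof (cases "\<alpha> \<in> sections Z")
    case True
    \<comment> \<open>The value of \<open>sections_map Y Z g\<close> must lie in
      \<open>sections Y\<close>, since \<open>sections_map X Y f\<close> is \<open>undefined\<close>
      elsewhere.\<close>
    then show ?thesis
      using assms sections_map_maps[OF assms(2)]
      by (auto simp: sections_map_def sections_def cont_comp_def cont_hom_def compose_def Let_def
          PiE_iff fun_eq_iff)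
  next
    case False
    then show ?thesis by (simp add: sections_map_def compose_def)
  qed
qed

lemma (in monad) mult_Hom:
  "X \<in> Obj C \<Longrightarrow> monad_mult C T ext X \<in> Hom C (T (T X)) (T X)"
  by (simp add: monad_mult_def ext_Hom T_Obj Id_Hom)

lemma (in monad) map_Hom:
  "\<lbrakk>X \<in> Obj C; Y \<in> Obj C; k \<in> Hom C X Y\<rbrakk>
    \<Longrightarrow> monad_map C T \<eta> ext X Y k \<in> Hom C (T X) (T Y)"
  unfolding monad_map_def by (intro ext_Hom Comp_Hom[of X Y "T Y"] T_Obj unit_Hom)

lemma representable_id:
  assumes "monad (Cont U) T \<eta> ext" "right_comodule U T \<eta> ext c" "X \<in> Obj (Cont U)"
  shows "representable U T c X X (\<lambda>\<alpha>\<in>sections X. \<alpha>)"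
  unfolding representable_def
  using monad.unit_Hom[OF assms(1,3)] right_comodule.c_counit[OF assms(2,3)] by metis

lemma representable_comp:
  assumes "monad (Cont U) T \<eta> ext" "right_comodule U T \<eta> ext c"
    and X: "X \<in> Obj (Cont U)" and Y: "Y \<in> Obj (Cont U)" and Z: "Z \<in> Obj (Cont U)"
    and F: "representable U T c X Y F" and G: "representable U T c Y Z G"
  shows "representable U T c X Z (compose (sections X) G F)"
proof -
  interpret monad "Cont U" T \<eta> ext by fact
  interpret right_comodule U T \<eta> ext c by fact
  let ?S = "sections X"
  obtain m where m: "m \<in> Hom (Cont U) Y (T X)"
    and F_eq: "F = compose ?S (sections_map Y (T X) m) (c X)"
    using F by (auto simp: representable_def)
  obtain n where n: "n \<in> Hom (Cont U) Z (T Y)"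
    and G_eq: "G = compose (sections Y) (sections_map Z (T Y) n) (c Y)"
    using G by (auto simp: representable_def)
  \<comment> \<open>These are \<mu>_X, T m and T m \<circ> n. The witness is bracketed as
    \<open>M\<close> after \<open>Kn\<close> because the two uses of
    \<open>sections_map_comp\<close> below absorb first \<open>K\<close>, then
    \<open>M\<close>.\<close>
  define M where "M = monad_mult (Cont U) T ext X"
  define K where "K = monad_map (Cont U) T \<eta> ext Y (T X) m"
  define Kn where "Kn = cont_comp Z (T Y) (T (T X)) K n"
  have M: "M \<in> Hom (Cont U) (T (T X)) (T X)"
    unfolding M_def using X by (rule mult_Hom)
  have K: "K \<in> Hom (Cont U) (T Y) (T (T X))"
    unfolding K_def using Y T_Obj[OF X] m by (rule map_Hom)
  have Kn: "Kn \<in> Hom (Cont U) Z (T (T X))"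
    using Comp_Hom[OF Z T_Obj[OF Y] T_Obj[OF T_Obj[OF X]] n K] by (simp add: Kn_def Cont_def)
  have MKn: "cont_comp Z (T (T X)) (T X) M Kn \<in> Hom (Cont U) Z (T X)"
    using Comp_Hom[OF Z T_Obj[OF T_Obj[OF X]] T_Obj[OF X] Kn M] by (simp add: Cont_def)
  have maps: "sections_map V W f \<in> sections W \<rightarrow> sections V" if "f \<in> Hom (Cont U) V W" for V W f
    using sections_map_maps[of f V W] that by (auto simp: Cont_def)
  have c: "c W \<in> sections W \<rightarrow> sections (T W)" if "W \<in> Obj (Cont U)" for W
    using c_maps[OF that] by blast
  have hom: "f \<in> cont_hom V W" if "f \<in> Hom (Cont U) V W" for V W f
    using that by (simp add: Cont_def)
  have pointwise: "G (F \<alpha>) = sections_map Z (T X) (cont_comp Z (T (T X)) (T X) M Kn) (c X \<alpha>)"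
    if \<alpha>: "\<alpha> \<in> ?S" for \<alpha>
  proof -
    \<comment> \<open>Each map below is restricted to a set of sections, so unfolding a composite at
      an argument requires that argument's membership.\<close>
    have c\<alpha>: "c X \<alpha> \<in> sections (T X)"
      using c[OF X] \<alpha> by blast
    have cc\<alpha>: "c (T X) (c X \<alpha>) \<in> sections (T (T X))"
      using c[OF T_Obj[OF X]] c\<alpha> by blast
    have "sections_map Y (T X) m (c X \<alpha>) \<in> sections Y"
      using maps[OF m] c\<alpha> by blast
    then have "G (F \<alpha>) = sections_map Z (T Y) n (c Y (sections_map Y (T X) m (c X \<alpha>)))"
      using \<alpha> by (simp add: F_eq G_eq compose_eq)
    \<comment> \<open>Naturality at \<open>m\<close>, evaluated at the section
      \<open>c X \<alpha>\<close>; the component \<open>c (T X)\<close> appears because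
      \<open>m\<close> has codomain \<open>T X\<close>.\<close>
    also have "c Y (sections_map Y (T X) m (c X \<alpha>))
        = sections_map (T Y) (T (T X)) K (c (T X) (c X \<alpha>))"
      using fun_cong[OF c_natural[OF Y T_Obj[OF X] m], of "c X \<alpha>"] c\<alpha>
      by (simp add: K_def compose_eq)
    also have "sections_map Z (T Y) n \<dots> = sections_map Z (T (T X)) Kn (c (T X) (c X \<alpha>))"
      unfolding Kn_def using sections_map_comp[OF hom[OF n] hom[OF K]] cc\<alpha>
      by (simp add: compose_eq)
    \<comment> \<open>Coassociativity trades the second use of \<open>c\<close> for \<mu>_X, leaving
      the single \<open>c X\<close> that representability demands.\<close>
    also have "c (T X) (c X \<alpha>) = sections_map (T (T X)) (T X) M (c X \<alpha>)"
      using fun_cong[OF c_coassoc[OF X], of \<alpha>] \<alpha> by (simp add: M_def compose_eq)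
    also have "sections_map Z (T (T X)) Kn \<dots>
        = sections_map Z (T X) (cont_comp Z (T (T X)) (T X) M Kn) (c X \<alpha>)"
      using sections_map_comp[OF hom[OF Kn] hom[OF M]] c\<alpha> by (simp add: compose_eq)
    finally show ?thesis .
  qed
  \<comment> \<open>Both composites are \<open>undefined\<close> outside \<open>sections X\<close>,
    so agreement on sections suffices.\<close>
  have "compose ?S G F
      = compose ?S (sections_map Z (T X) (cont_comp Z (T (T X)) (T X) M Kn)) (c X)"
    using pointwise by (auto simp: compose_def fun_eq_iff)
  with MKn show ?thesis
    by (auto simp: representable_def)
qed

theorem theorem6:
  fixes U :: "'u set set"
    and T :: "'u container \<Rightarrow> 'u container"
    and \<eta> :: "'u container \<Rightarrow> 'u cont_mor"
    and ext :: "'u container \<Rightarrow> 'u container \<Rightarrow> 'u cont_mor \<Rightarrow> 'u cont_mor"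
    and c :: "'u container \<Rightarrow> ('u \<Rightarrow> 'u) \<Rightarrow> ('u \<Rightarrow> 'u)"
  assumes "monad (Cont U) T \<eta> ext"
    and "right_comodule U T \<eta> ext c"
  shows "(\<forall>X \<in> containers U. representable U T c X X (\<lambda>\<alpha>\<in>sections X. \<alpha>)) \<and>
    (\<forall>X \<in> containers U. \<forall>Y \<in> containers U. \<forall>Z \<in> containers U.
      \<forall>F \<in> sections X \<rightarrow>\<^sub>E sections Y. \<forall>G \<in> sections Y \<rightarrow>\<^sub>E sections Z.
        representable U T c X Y F \<longrightarrow> representable U T c Y Z G \<longrightarrow>
        representable U T c X Z (compose (sections X) G F)) \<and>
    subcategory (RFun U T c) (Fun U)"
proof -
  have [simp]: "Obj (Cont U) = containers U" "Obj (Fun U) = containers U"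
    by (simp_all add: Cont_def Fun_def)
  note id = representable_id[OF assms, simplified]
    and comp = representable_comp[OF assms, simplified]
  interpret category "Fun U" by (rule category_Fun)
  have "subcategory (RFun U T c) (Fun U)"
    unfolding RFun_def
  \<comment> \<open>The hom-sets of \<open>RFun\<close> are cut out of those of
    \<open>Fun U\<close>, so their inclusion is left to the closing \<open>auto\<close>; the two
    closure conditions are the substance.\<close>
  proof (rule subcategory_Hom_update[OF category_Fun])
    show "Id (Fun U) X \<in> {F \<in> Hom (Fun U) X X. representable U T c X X F}"
      if "X \<in> Obj (Fun U)" for X
      using Id_Hom[OF that] id[of X] that by (simp add: Fun_def)
    show "Comp (Fun U) X Y Z G F \<in> {F \<in> Hom (Fun U) X Z. representable U T c X Z F}"
      if "X \<in> Obj (Fun U)" "Y \<in> Obj (Fun U)" "Z \<in> Obj (Fun U)"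
        "F \<in> {F \<in> Hom (Fun U) X Y. representable U T c X Y F}"
        "G \<in> {G \<in> Hom (Fun U) Y Z. representable U T c Y Z G}" for X Y Z F G
      using Comp_Hom[of X Y Z F G] comp[of X Y Z F G] that by (simp add: Fun_def)
  qed auto
  with id comp show ?thesis by blast
qed

end
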